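(* Let $\Omega\subseteq\mathbb{R}^n$ be open and let $u:\Omega\to\mathbb{R}^N$ be a map in $C^2(\Omega)^N$. Then: (i) If $u$ is an $\infty$-Minimal Map with respect to the functional $\|Du\|_{L^\infty(\Omega)}$, then $u$ is $\infty$-Harmonic on $\Omega$, i.e. it solves $$\Delta_\infty u := \Big(Du\otimes Du + |Du|^2[Du]^\bot\otimes I\Big):D^2u = 0 \quad\text{on }\Omega .$$ If $u$ is an immersion, the converse is true as well: if $u$ is $\infty$-Harmonic on $\Omega$, then $u$ is an $\infty$-Minimal Map. In particular, the following assertions hold for the tangential and the normal part separately: (ii) If $u$ is a Rank-One Absolute Minimal on $\Omega$, then $u$ is tangentially $\infty$-Harmonic on $\Omega$, i.e. it solves $Du\otimes Du:D^2u=0$ on $\Omega$. The converse is true if $u$ is an immersion. (iii) Suppose $u$ is an immersion. Then $u(\Omega)$ has $\infty$-Minimal Area if and only if $u$ is normally $\infty$-Harmonic on $\Omega$, i.e. it solves $|Du|^2[Du]^\bot\Delta u=0$ on $\Omega$.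
   Context: Here $n,N\in\mathbb{N}$. For $u=(u_1,\dots,u_N):\Omega\subseteq\mathbb{R}^n\to\mathbb{R}^N$, $Du(x)\in\mathbb{R}^{N\times n}$ is the gradient matrix with entries $D_iu_\alpha$, $|Du|=(\sum_{\alpha,i}(D_iu_\alpha)^2)^{1/2}$ is its Euclidean (Frobenius) norm, and $\|Du\|_{L^\infty(D)}=\operatorname{ess\,sup}_D|Du|$. For a matrix $P\in\mathbb{R}^{N\times n}$, $[P]^\bot$ is the orthogonal projection of $\mathbb{R}^N$ onto the nullspace of $P^\top$ (the orthogonal complement of the range of $P$). In components (summing over repeated indices): - $(Du\otimes Du:D^2u)_\alpha = D_iu_\alpha\, D_ju_\beta\, D^2_{ij}u_\beta$; - $(|Du|^2[Du]^\bot\Delta u)_\alpha=|Du|^2[Du]^\bot_{\alpha\beta}D^2_{ii}u_\beta$; - $\Delta_\infty u = Du\otimes Du:D^2u+|Du|^2[Du]^\bot\Delta u$. A $C^1$ map $u$ is an immersion if $\operatorname{rk}(Du)=n\le N$ everywhere on $\Omega$, a submersion if $\operatorname{rk}(Du)=N\le n$ everywhere, and a Full-Rank map if $\operatorname{rk}(Du)=\min\{n,N\}$ everywhere on $\Omega$. $D\subset\subset\Omega$ means that $D$ is a subdomain (open subset) whose closure is compact and contained in $\Omega$. $C^1_0(D)$ is the set of real-valued $C^1$ functions on $D$, continuous on $\overline D$, vanishing on $\partial D$ (their gradient need not vanish on $\partial D$). $C^1(\overline D)$ is the set of real-valued functions that are $C^1$ up to the boundary. $\mathbb{S}^{N-1}$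 is the unit sphere of $\mathbb{R}^N$. $\Gamma([Du]^\bot)$ is the set of normal vector fields along $u$, i.e. $C^1$ maps $\nu:\Omega\to\mathbb{R}^N$ with $\nu(x)^\top Du(x)=0$ for all $x\in\Omega$. Definitions. Let $u\in C^1(\Omega)^N$. (a) $u$ is a Rank-One Absolute Minimal on $\Omega$ if for all $D\subset\subset\Omega$, all $g\in C^1_0(D)$ and all $\xi\in\mathbb{S}^{N-1}$, $\|Du\|_{L^\infty(D)}\le\|D(u+g\xi)\|_{L^\infty(D)}$. (b) If $u$ is an immersion, $u(\Omega)$ has $\infty$-Minimal Area if for all $D\subset\subset\Omega$, all $h\in C^1(\overline D)$ and all $\nu\in\Gamma([Du]^\bot)$, $\|Du\|_{L^\infty(D)}\le\|D(u+h\nu)\|_{L^\infty(D)}$. (c) If $u$ is a Full-Rank map, $u$ is an $\infty$-Minimal Map with respect to $\|Du\|_{L^\infty(\Omega)}$ if $u$ is a Rank-One Absolute Minimal on $\Omega$ and $u(\Omega)$ has $\infty$-Minimal Area. The latter condition is regarded as empty (automatically satisfied) when $u$ is a submersion, since then $[Du]^\bot=0$. *)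

theory Defs
  imports "HOL-Analysis.Analysis" "HOL-Probability.Essential_Supremum"
begin

text \<open>
  Maps on an open set are represented by total functions; only their values on that set (and,
  where boundary values are involved, on its closure) are ever used. The gradient matrix of
  \<open>u\<close> at \<open>x\<close> is \<open>jacobian u (at x) :: real^'n^'N\<close>, whose entry \<open>$ \<alpha> $ i\<close> is
  \<open>D\<^sub>i u\<^sub>\<alpha>\<close>, and whose \<open>norm\<close> is the Frobenius norm.
\<close>

section \<open>Function spaces on open sets\<close>

definition C1_on :: "'a::real_normed_vector set \<Rightarrow> ('a \<Rightarrow> 'b::real_normed_vector) \<Rightarrow> bool"
  where "C1_on S f \<longleftrightarrow>
    (\<exists>f' :: 'a \<Rightarrow> ('a \<Rightarrow>\<^sub>L 'b). (\<forall>x\<in>S. (f has_derivative blinfun_apply (f' x)) (at x)) \<and>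
      continuous_on S f')"

definition C2_on :: "'a::real_normed_vector set \<Rightarrow> ('a \<Rightarrow> 'b::real_normed_vector) \<Rightarrow> bool"
  where "C2_on S f \<longleftrightarrow>
    (\<exists>f' :: 'a \<Rightarrow> ('a \<Rightarrow>\<^sub>L 'b). (\<forall>x\<in>S. (f has_derivative blinfun_apply (f' x)) (at x)) \<and>
      C1_on S f')"

definition compactly_inside :: "'a::topological_space set \<Rightarrow> 'a set \<Rightarrow> bool"  (infix \<open>\<subset>\<subset>\<close> 50)
  where "D \<subset>\<subset> \<Omega> \<longleftrightarrow> open D \<and> compact (closure D) \<and> closure D \<subseteq> \<Omega>"

definition C1_0 :: "'a::real_normed_vector set \<Rightarrow> ('a \<Rightarrow> real) set"
  where "C1_0 D = {g. C1_on D g \<and> continuous_on (closure D) g \<and> (\<forall>x\<in>frontier D. g x = 0)}"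

text \<open>\<open>C\<^sup>1\<close> up to the boundary: the function and its derivative on \<open>D\<close> both extend
  continuously to the closure of \<open>D\<close>.\<close>

definition C1_closure :: "'a::real_normed_vector set \<Rightarrow> ('a \<Rightarrow> real) set"
  where "C1_closure D = {h. continuous_on (closure D) h \<and>
    (\<exists>h' :: 'a \<Rightarrow> ('a \<Rightarrow>\<^sub>L real). (\<forall>x\<in>D. (h has_derivative blinfun_apply (h' x)) (at x)) \<and>
      continuous_on (closure D) h')}"

section \<open>The supremal functional\<close>

text \<open>Valued in \<^typ>\<open>ennreal\<close>, since the gradient of \<open>u + g \<xi>\<close> with \<open>g \<in> C1_0 D\<close> may be
  unbounded near the boundary of \<open>D\<close>.\<close>

definition sup_grad :: "(real^'n) set \<Rightarrow> (real^'n \<Rightarrow> real^'N) \<Rightarrow> ennreal"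
  where "sup_grad D v = esssup (lebesgue_on D) (\<lambda>x. ennreal (norm (jacobian v (at x))))"

section \<open>The \<open>\<infinity>\<close>-Laplacian\<close>

definition orth_proj :: "(real^'N) set \<Rightarrow> real^'N^'N"
  where "orth_proj V =
    (THE Q. \<forall>v. Q *v v \<in> V \<and> (\<forall>w\<in>V. orthogonal (v - Q *v v) w))"

lemma orth_proj_ex1:
  fixes V :: "(real^'N) set"
  assumes "subspace V"
  shows "\<exists>!Q :: real^'N^'N. \<forall>v. Q *v v \<in> V \<and> (\<forall>w\<in>V. orthogonal (v - Q *v v) w)"
proof -
  let ?P = "\<lambda>v p. p \<in> V \<and> (\<forall>w\<in>V. orthogonal (v - p) w)"
  have ex: "\<exists>p. ?P v p" for v
  proof -
    obtain y z where "y \<in> span V" "\<And>w. w \<in> span V \<Longrightarrow> orthogonal z w" "v = y + z"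
      using orthogonal_subspace_decomp_exists[of V v] by metis
    then show ?thesis using assms by (intro exI[of _ y]) (simp add: span_eq_iff[THEN iffD2])
  qed
  have uniq: "p = q" if "?P v p" "?P v q" for v p q
  proof -
    have "p - q \<in> V" using that assms by (simp add: subspace_diff)
    then have "orthogonal (v - q) (p - q)" "orthogonal (v - p) (p - q)" using that by auto
    then have "(p - q) \<bullet> (p - q) = 0" by (simp add: orthogonal_def inner_diff_left)
    then show ?thesis by simp
  qed
  obtain f where f: "\<And>v. ?P v (f v)" using ex by metis
  have "linear f"
  proof (rule linearI)
    fix x y :: "real^'N" and c :: real
    have "?P (x + y) (f x + f y)"
      using f[of x] f[of y] assms
      by (auto simp: subspace_add orthogonal_def inner_diff_left inner_add_left)
    then show "f (x + y) = f x + f y" using uniq f by blast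
    have "?P (c *\<^sub>R x) (c *\<^sub>R f x)"
      using f[of x] assms by (auto simp: subspace_scale orthogonal_def inner_diff_left)
    then show "f (c *\<^sub>R x) = c *\<^sub>R f x" using uniq f by blast
  qed
  then have mf: "matrix f *v v = f v" for v by simp
  show ?thesis
  proof (rule ex1I[of _ "matrix f"])
    show "\<forall>v. ?P v (matrix f *v v)" using f mf by simp
    fix Q :: "real^'N^'N" assume "\<forall>v. ?P v (Q *v v)"
    then have "Q *v v = matrix f *v v" for v using f mf uniq by metis
    then show "Q = matrix f" by (simp add: matrix_eq)
  qed
qed

definition perp :: "real^'n^'N \<Rightarrow> real^'N^'N"
  where "perp P = orth_proj {v. transpose P *v v = 0}"

lemma perp_works:
  fixes P :: "real^'n^'N"
  shows "transpose P *v (perp P *v v) = 0"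
    and "transpose P *v w = 0 \<Longrightarrow> orthogonal (v - perp P *v v) w"
proof -
  have "subspace {v. transpose P *v v = 0}"
    by (rule linear_subspace_kernel[OF matrix_vector_mul_linear])
  from theI'[OF orth_proj_ex1[OF this]]
  show "transpose P *v (perp P *v v) = 0"
    and "transpose P *v w = 0 \<Longrightarrow> orthogonal (v - perp P *v v) w"
    unfolding perp_def orth_proj_def by simp_all
qed

text \<open>\<open>D2 u x i j \<beta>\<close> is the second partial derivative \<open>D\<^sub>i (D\<^sub>j u\<^sub>\<beta>)\<close> at \<open>x\<close>.\<close>

definition D2 :: "(real^'n \<Rightarrow> real^'N) \<Rightarrow> real^'n \<Rightarrow> 'n \<Rightarrow> 'n \<Rightarrow> 'N \<Rightarrow> real"
  where "D2 u x i j \<beta> = frechet_derivative (\<lambda>y. jacobian u (at y) $ \<beta> $ j) (at x) (axis i 1)"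

definition tangential_inf_laplacian :: "(real^'n \<Rightarrow> real^'N) \<Rightarrow> real^'n \<Rightarrow> real^'N"
  where "tangential_inf_laplacian u x = (\<chi> \<alpha>. \<Sum>i\<in>UNIV. \<Sum>j\<in>UNIV. \<Sum>\<beta>\<in>UNIV.
    jacobian u (at x) $ \<alpha> $ i * jacobian u (at x) $ \<beta> $ j * D2 u x i j \<beta>)"

definition normal_inf_laplacian :: "(real^'n \<Rightarrow> real^'N) \<Rightarrow> real^'n \<Rightarrow> real^'N"
  where "normal_inf_laplacian u x = (\<chi> \<alpha>. \<Sum>\<beta>\<in>UNIV. \<Sum>i\<in>UNIV.
    (norm (jacobian u (at x)))\<^sup>2 * perp (jacobian u (at x)) $ \<alpha> $ \<beta> * D2 u x i i \<beta>)"

definition inf_laplacian :: "(real^'n \<Rightarrow> real^'N) \<Rightarrow> real^'n \<Rightarrow> real^'N"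
  where "inf_laplacian u x = tangential_inf_laplacian u x + normal_inf_laplacian u x"

section \<open>Rank conditions\<close>

definition immersion_on :: "(real^'n) set \<Rightarrow> (real^'n \<Rightarrow> real^'N) \<Rightarrow> bool"
  where "immersion_on \<Omega> u \<longleftrightarrow> C1_on \<Omega> u \<and> CARD('n) \<le> CARD('N) \<and>
    (\<forall>x\<in>\<Omega>. rank (jacobian u (at x)) = CARD('n))"

definition submersion_on :: "(real^'n) set \<Rightarrow> (real^'n \<Rightarrow> real^'N) \<Rightarrow> bool"
  where "submersion_on \<Omega> u \<longleftrightarrow> C1_on \<Omega> u \<and> CARD('N) \<le> CARD('n) \<and>
    (\<forall>x\<in>\<Omega>. rank (jacobian u (at x)) = CARD('N))"

definition full_rank_on :: "(real^'n) set \<Rightarrow> (real^'n \<Rightarrow> real^'N) \<Rightarrow> bool"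
  where "full_rank_on \<Omega> u \<longleftrightarrow> C1_on \<Omega> u \<and>
    (\<forall>x\<in>\<Omega>. rank (jacobian u (at x)) = min CARD('n) CARD('N))"

section \<open>Variational notions\<close>

definition normal_fields :: "(real^'n) set \<Rightarrow> (real^'n \<Rightarrow> real^'N) \<Rightarrow> (real^'n \<Rightarrow> real^'N) set"
  where "normal_fields \<Omega> u = {\<nu>. C1_on \<Omega> \<nu> \<and> (\<forall>x\<in>\<Omega>. \<nu> x v* jacobian u (at x) = 0)}"

definition rank_one_absolute_minimal :: "(real^'n) set \<Rightarrow> (real^'n \<Rightarrow> real^'N) \<Rightarrow> bool"
  where "rank_one_absolute_minimal \<Omega> u \<longleftrightarrow> C1_on \<Omega> u \<and>
    (\<forall>D g \<xi>. D \<subset>\<subset> \<Omega> \<longrightarrow> g \<in> C1_0 D \<longrightarrow> \<xi> \<in> sphere 0 1 \<longrightarrow>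
      sup_grad D u \<le> sup_grad D (\<lambda>x. u x + g x *\<^sub>R \<xi>))"

definition inf_minimal_area :: "(real^'n) set \<Rightarrow> (real^'n \<Rightarrow> real^'N) \<Rightarrow> bool"
  where "inf_minimal_area \<Omega> u \<longleftrightarrow> immersion_on \<Omega> u \<and>
    (\<forall>D h \<nu>. D \<subset>\<subset> \<Omega> \<longrightarrow> h \<in> C1_closure D \<longrightarrow> \<nu> \<in> normal_fields \<Omega> u \<longrightarrow>
      sup_grad D u \<le> sup_grad D (\<lambda>x. u x + h x *\<^sub>R \<nu> x))"

text \<open>A full-rank map is an immersion or a submersion; for submersions there are no nonzero
  normal directions and the minimal area condition is void.\<close>

definition inf_minimal_map :: "(real^'n) set \<Rightarrow> (real^'n \<Rightarrow> real^'N) \<Rightarrow> bool"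
  where "inf_minimal_map \<Omega> u \<longleftrightarrow> full_rank_on \<Omega> u \<and> rank_one_absolute_minimal \<Omega> u \<and>
    (submersion_on \<Omega> u \<or> inf_minimal_area \<Omega> u)"

end

theory Submission
  imports Defs
begin

text \<open>
  Everything rests on the expansion, for \<open>v = u + h \<nu>\<close>, \<open>E = h D\<nu> + \<nu> \<otimes> \<nabla>h\<close> and the Frobenius inner
  product, \<open>|Dv|\<^sup>2 = |Du|\<^sup>2 + 2 Du : E + |E|\<^sup>2\<close>.
  The supremal functional of a \<open>C\<^sup>1\<close> map on an open set is a plain supremum
  (\<open>sup_grad_eq_SUP\<close>), so only pointwise values of gradients matter.

  \<^emph>\<open>Tangential part.\<close> The vector \<open>Du \<otimes> Du : D\<^sup>2u\<close> is \<open>Du \<nabla>(|Du|\<^sup>2 / 2)\<close>. If it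
  does not vanish at a point, let \<open>\<xi>\<close> be its direction: along \<open>\<xi>\<close> a quadratic bump \<open>g\<close> on a small ball
  keeps the value of \<open>|Du|\<^sup>2\<close> at the centre but makes its gradient there shorter,
  and on small balls a shorter gradient means a smaller supremum
  (\<open>smaller_gradient_smaller_sup\<close>). Conversely, if \<open>u\<close> is an immersion and the vector
  vanishes everywhere, then \<open>\<nabla>|Du|\<^sup>2 = 0\<close>, so \<open>|Du|\<close> is constant on each component of \<open>D\<close>; a
  function \<open>g\<close> vanishing on the boundary has a critical point in that component, and there
  \<open>u + g \<xi>\<close> has the same gradient as \<open>u\<close>.

  \<^emph>\<open>Normal part.\<close> For a normal field \<open>\<nu>\<close>, differentiating \<open>\<nu>\<^sup>T Du = 0\<close> gives
  \<open>Du : D\<nu> = - \<Delta>u \<bullet> \<nu>\<close> (\<open>normal_field_inner_jacobian\<close>), while \<open>Du : (\<nu> \<otimes> \<nabla>h) = 0\<close>. If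
  \<open>\<Delta>u\<close> has no normal component, the mixed term in the expansion therefore vanishes and
  \<open>|Du| \<le> |D(u + h \<nu>)|\<close> at every point. If it has one at some point, there is a normal field with
  \<open>Du : D\<nu> \<noteq> 0\<close> there (\<open>normal_field_through\<close>), and adding a suitable constant multiple of it
  decreases \<open>|Du|\<close> near this point.

  \<^emph>\<open>Full operator.\<close> Its two parts take values in the range of \<open>Du\<close> and in the orthogonal complement
  of that range, so that the sum vanishes only if both do. For a submersion this complement is
  trivial, which makes the normal part vanish without any minimality of area.
\<close>

section \<open>Calculus of continuously differentiable maps\<close>

lemma C1_onI:
  assumes "\<And>x. x \<in> S \<Longrightarrow> (f has_derivative blinfun_apply (f' x)) (at x)" "continuous_on S f'"
  shows "C1_on S f"
  using assms unfolding C1_on_def by blast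

lemma C1_onE:
  assumes "C1_on S f"
  obtains f' where "\<And>x. x \<in> S \<Longrightarrow> (f has_derivative blinfun_apply (f' x)) (at x)"
    and "continuous_on S f'"
  using assms unfolding C1_on_def by blast

lemma C1_on_imp_continuous_on: "C1_on S f \<Longrightarrow> continuous_on S f"
  by (meson C1_onE continuous_at_imp_continuous_on has_derivative_continuous)

lemma C1_on_imp_differentiable: "C1_on S f \<Longrightarrow> x \<in> S \<Longrightarrow> f differentiable (at x)"
  by (meson C1_onE differentiable_def)

lemma C1_on_subset: "C1_on S f \<Longrightarrow> T \<subseteq> S \<Longrightarrow> C1_on T f"
  unfolding C1_on_def by (meson continuous_on_subset subsetD)

lemma C1_on_cong:
  assumes "C1_on S f" "open S" "\<And>x. x \<in> S \<Longrightarrow> f x = g x"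
  shows "C1_on S g"
proof -
  obtain f' where f': "\<And>x. x \<in> S \<Longrightarrow> (f has_derivative blinfun_apply (f' x)) (at x)"
    "continuous_on S f'" using C1_onE[OF assms(1)] by blast
  have "(g has_derivative blinfun_apply (f' x)) (at x)" if "x \<in> S" for x
    by (rule has_derivative_transform_within_open[OF f'(1)[OF that] assms(2) that assms(3)])
  with f'(2) show ?thesis unfolding C1_on_def by blast
qed

lemma C1_on_const: "C1_on S (\<lambda>x. c)"
  by (rule C1_onI[of _ _ "\<lambda>_. 0"]) (auto simp: zero_blinfun.rep_eq)

lemma C1_on_add:
  assumes "C1_on S f" "C1_on S g" shows "C1_on S (\<lambda>x. f x + g x)"
proof -
  obtain f' where f': "\<And>x. x \<in> S \<Longrightarrow> (f has_derivative blinfun_apply (f' x)) (at x)"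
    "continuous_on S f'" using C1_onE[OF assms(1)] by blast
  obtain g' where g': "\<And>x. x \<in> S \<Longrightarrow> (g has_derivative blinfun_apply (g' x)) (at x)"
    "continuous_on S g'" using C1_onE[OF assms(2)] by blast
  show ?thesis
  proof (rule C1_onI)
    show "((\<lambda>x. f x + g x) has_derivative blinfun_apply (f' x + g' x)) (at x)" if "x \<in> S" for x
      using has_derivative_add[OF f'(1)[OF that] g'(1)[OF that]] by (simp add: plus_blinfun.rep_eq)
    show "continuous_on S (\<lambda>x. f' x + g' x)" by (intro continuous_on_add f' g')
  qed
qed

lemma C1_on_scaleR:
  fixes f :: "'a::real_normed_vector \<Rightarrow> real"
  assumes "C1_on S f" "C1_on S g" shows "C1_on S (\<lambda>x. f x *\<^sub>R g x)"
proof -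
  obtain f' where f': "\<And>x. x \<in> S \<Longrightarrow> (f has_derivative blinfun_apply (f' x)) (at x)"
    "continuous_on S f'" using C1_onE[OF assms(1)] by blast
  obtain g' where g': "\<And>x. x \<in> S \<Longrightarrow> (g has_derivative blinfun_apply (g' x)) (at x)"
    "continuous_on S g'" using C1_onE[OF assms(2)] by blast
  have cont: "continuous_on S f" "continuous_on S g"
    using assms by (auto intro: C1_on_imp_continuous_on)
  let ?d = "\<lambda>x. f x *\<^sub>R g' x + (blinfun_scaleR_left (g x) o\<^sub>L f' x)"
  show ?thesis
  proof (rule C1_onI)
    show "((\<lambda>x. f x *\<^sub>R g x) has_derivative blinfun_apply (?d x)) (at x)" if "x \<in> S" for x
      by (rule has_derivative_eq_rhs[OF has_derivative_scaleR[OF f'(1)[OF that] g'(1)[OF that]]])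
        (simp add: fun_eq_iff blinfun.add_left blinfun.scaleR_left)
    show "continuous_on S ?d"
      by (intro continuous_on_add continuous_on_scaleR f' g' cont
          bounded_bilinear.continuous_on[OF bounded_bilinear_blinfun_compose]
          bounded_linear.continuous_on[OF bounded_linear_blinfun_scaleR_left])
  qed
qed

lemma C1_on_linear:
  assumes "C1_on S f" "bounded_linear L" shows "C1_on S (\<lambda>x. L (f x))"
proof -
  obtain f' where f': "\<And>x. x \<in> S \<Longrightarrow> (f has_derivative blinfun_apply (f' x)) (at x)"
    "continuous_on S f'" using C1_onE[OF assms(1)] by blast
  show ?thesis
  proof (rule C1_onI)
    show "((\<lambda>x. L (f x)) has_derivative blinfun_apply (Blinfun L o\<^sub>L f' x)) (at x)"
      if "x \<in> S" for x
      by (rule has_derivative_eq_rhs[OF bounded_linear.has_derivative[OF assms(2) f'(1)[OF that]]])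
        (simp add: fun_eq_iff bounded_linear_Blinfun_apply[OF assms(2)])
    show "continuous_on S (\<lambda>x. Blinfun L o\<^sub>L f' x)"
      by (intro f' continuous_on_const
          bounded_bilinear.continuous_on[OF bounded_bilinear_blinfun_compose])
  qed
qed

lemma C1_on_mult:
  fixes f g :: "'a::real_normed_vector \<Rightarrow> real"
  assumes "C1_on S f" "C1_on S g" shows "C1_on S (\<lambda>x. f x * g x)"
  using C1_on_scaleR[OF assms] by simp

lemma C1_on_diff:
  assumes "C1_on S f" "C1_on S g" shows "C1_on S (\<lambda>x. f x - g x)"
  using C1_on_add[OF assms(1) C1_on_linear[OF assms(2) bounded_linear_minus[OF bounded_linear_ident]]]
  by simp

lemma C1_on_sum:
  "(\<And>i. i \<in> I \<Longrightarrow> C1_on S (f i)) \<Longrightarrow> C1_on S (\<lambda>x. \<Sum>i\<in>I. f i x)"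
  by (induction I rule: infinite_finite_induct) (auto intro: C1_on_const C1_on_add)

lemma C1_on_prod:
  fixes f :: "'i \<Rightarrow> 'a::real_normed_vector \<Rightarrow> real"
  shows "(\<And>i. i \<in> I \<Longrightarrow> C1_on S (f i)) \<Longrightarrow> C1_on S (\<lambda>x. \<Prod>i\<in>I. f i x)"
  by (induction I rule: infinite_finite_induct) (auto intro: C1_on_const C1_on_mult)

lemma C1_on_vec_nth:
  fixes f :: "'a::real_normed_vector \<Rightarrow> ('b::real_normed_vector)^'m"
  shows "C1_on S f \<Longrightarrow> C1_on S (\<lambda>x. f x $ i)"
  by (rule C1_on_linear[OF _ bounded_linear_vec_nth])

lemma C1_on_vec_lambda:
  fixes f :: "'m::finite \<Rightarrow> 'a::real_normed_vector \<Rightarrow> 'b::euclidean_space"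
  assumes "\<And>i. C1_on S (f i)" shows "C1_on S (\<lambda>x. \<chi> i. f i x)"
proof -
  have "bounded_linear (axis i :: 'b \<Rightarrow> 'b^'m)" for i :: 'm
    by (intro linear_conv_bounded_linear[THEN iffD1] linearI) (auto simp: vec_eq_iff axis_def)
  then have "C1_on S (\<lambda>x. \<Sum>i\<in>UNIV. (axis i (f i x) :: 'b^'m))"
    by (intro C1_on_sum C1_on_linear[OF assms])
  moreover have "(\<Sum>i\<in>UNIV. axis i (f i x)) = (\<chi> i. f i x)" for x
    by (simp add: vec_eq_iff axis_def if_distrib cong: if_cong)
  ultimately show ?thesis by simp
qed

text \<open>The determinant is a polynomial in the entries.\<close>

lemma C1_on_det:
  fixes A :: "'a::real_normed_vector \<Rightarrow> real^'m^'m"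
  assumes "\<And>i j. C1_on S (\<lambda>x. A x $ i $ j)" shows "C1_on S (\<lambda>x. det (A x))"
  unfolding det_def by (intro C1_on_sum C1_on_mult C1_on_const C1_on_prod assms)

lemma C1_on_has_jacobian:
  fixes f :: "real^'n \<Rightarrow> real^'m"
  shows "C1_on S f \<Longrightarrow> x \<in> S \<Longrightarrow> (f has_derivative (*v) (jacobian f (at x))) (at x)"
  using C1_on_imp_differentiable jacobian_works by blast

lemma jacobian_eqI:
  fixes f :: "real^'n \<Rightarrow> real^'m"
  assumes "(f has_derivative (*v) A) (at x)" shows "jacobian f (at x) = A"
  unfolding jacobian_def frechet_derivative_at[OF assms, symmetric] by simp

lemma matrix_entry_eq: "(A :: real^'n^'m) $ i $ j = (A *v axis j 1) $ i"
  by (simp add: matrix_vector_mult_basis column_def)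

lemma continuous_on_jacobian:
  fixes f :: "real^'n \<Rightarrow> real^'m"
  assumes "C1_on S f" shows "continuous_on S (\<lambda>x. jacobian f (at x))"
proof -
  obtain f' where f': "\<And>x. x \<in> S \<Longrightarrow> (f has_derivative blinfun_apply (f' x)) (at x)"
    "continuous_on S f'" using C1_onE[OF assms] by blast
  have "continuous_on S (\<lambda>x. \<chi> i j. f' x (axis j 1) $ i)"
    by (intro continuous_intros f')
  moreover have "(\<chi> i j. f' x (axis j 1) $ i) = jacobian f (at x)" if "x \<in> S" for x
    using frechet_derivative_at[OF f'(1)[OF that]] by (simp add: jacobian_def matrix_def)
  ultimately show ?thesis by (simp cong: continuous_on_cong)
qed

lemma C2_on_imp_C1_on: "C2_on S f \<Longrightarrow> C1_on S f"
  unfolding C2_on_def by (metis C1_on_def C1_on_imp_continuous_on)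

lemma C1_on_jacobian:
  fixes u :: "real^'n \<Rightarrow> real^'N"
  assumes "open S" "C2_on S u" shows "C1_on S (\<lambda>x. jacobian u (at x))"
proof -
  obtain f' where f': "\<And>x. x \<in> S \<Longrightarrow> (u has_derivative blinfun_apply (f' x)) (at x)"
    "C1_on S f'" using assms(2) unfolding C2_on_def by blast
  have bl: "bounded_linear (\<lambda>g. blinfun_apply g (axis j 1) $ i)" for i :: 'N and j :: 'n
    by (intro bounded_linear_compose[OF bounded_linear_vec_nth] blinfun.bounded_linear_left)
  have "C1_on S (\<lambda>x. \<chi> i j. f' x (axis j 1) $ i)"
    by (intro C1_on_vec_lambda C1_on_linear[OF f'(2) bl])
  then show ?thesis
  proof (rule C1_on_cong[OF _ assms(1)])
    fix x assume "x \<in> S"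
    then show "(\<chi> i j. f' x (axis j 1) $ i) = jacobian u (at x)"
      using frechet_derivative_at[OF f'(1)] by (simp add: jacobian_def matrix_def)
  qed
qed

lemma linear_functional_inner:
  fixes f :: "'a::euclidean_space \<Rightarrow> real"
  assumes "linear f" obtains p where "f = (\<lambda>k. p \<bullet> k)"
proof
  show "f = (\<lambda>k. adjoint f 1 \<bullet> k)"
    using adjoint_works[OF assms, of _ 1] by (auto simp: inner_commute)
qed

section \<open>The supremal functional for continuously differentiable maps\<close>

text \<open>A nonempty open set is not negligible; this is what turns essential suprema of continuous
  functions into suprema.\<close>

lemma AE_lebesgue_on_open_nonempty:
  fixes D :: "'a::euclidean_space set"
  assumes "open D" "open U" "U \<subseteq> D" "U \<noteq> {}" "AE x in lebesgue_on D. P x"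
  shows "\<exists>x\<in>U. P x"
proof (rule ccontr)
  assume "\<not> ?thesis"
  moreover have "AE x in lebesgue. x \<in> D \<longrightarrow> P x"
    using assms(1,5) by (simp add: AE_restrict_space_iff)
  ultimately have "AE x in lebesgue. x \<notin> U"
    using assms(3) by (auto elim!: eventually_mono)
  then have "negligible U"
    using assms(2) by (simp add: negligible_iff_null_sets AE_iff_null_sets)
  then show False using assms(2,4) open_not_negligible by blast
qed

lemma sup_grad_eq_SUP:
  fixes v :: "real^'n \<Rightarrow> real^'N"
  assumes "open D" "C1_on D v"
  shows "sup_grad D v = (SUP x\<in>D. ennreal (norm (jacobian v (at x))))"
proof (rule antisym)
  let ?f = "\<lambda>x. norm (jacobian v (at x))"
  have cont: "continuous_on D ?f"
    by (intro continuous_intros continuous_on_jacobian assms)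
  have meas: "(\<lambda>x. ennreal (?f x)) \<in> borel_measurable (lebesgue_on D)"
    using cont assms(1)
    by (intro measurable_compose[OF _ measurable_ennreal]
        continuous_imp_measurable_on_sets_lebesgue) auto
  show "sup_grad D v \<le> (SUP x\<in>D. ennreal (?f x))"
    unfolding sup_grad_def
    by (intro esssup_I meas AE_I2) (auto intro: SUP_upper)
  show "(SUP x\<in>D. ennreal (?f x)) \<le> sup_grad D v"
  proof (rule SUP_least, rule ccontr)
    fix x assume x: "x \<in> D" and "\<not> ennreal (?f x) \<le> sup_grad D v"
    then have less: "sup_grad D v < ennreal (?f x)" by simp
    define c where "c = enn2real (sup_grad D v)"
    have "sup_grad D v < top" using less ennreal_less_top by (rule less_trans)
    then have c: "sup_grad D v = ennreal c" "0 \<le> c"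
      unfolding c_def by (rule ennreal_enn2real[symmetric]) (rule enn2real_nonneg)
    define U where "U = {y \<in> D. c < ?f y}"
    have "U = D \<inter> ?f -` {c<..}" by (auto simp: U_def)
    then have "open U" using continuous_open_preimage[OF cont assms(1) open_greaterThan[of c]] by simp
    moreover have "x \<in> U" using less c x by (simp add: U_def ennreal_less_iff)
    moreover have "AE y in lebesgue_on D. ennreal (?f y) \<le> sup_grad D v"
      unfolding sup_grad_def by (rule esssup_AE)
    ultimately obtain y where "y \<in> U" "ennreal (?f y) \<le> sup_grad D v"
      using AE_lebesgue_on_open_nonempty[OF assms(1), of U] unfolding U_def by blast
    then show False using c by (auto simp: U_def ennreal_le_iff)
  qed
qed

text \<open>All strict comparisons of the functional are made through a number \<open>M\<close> that separates the two
  suprema; pointwise strict inequality alone would be lost when the supremum is taken.\<close>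

lemma sup_grad_less:
  fixes u v :: "real^'n \<Rightarrow> real^'N"
  assumes "open D" "C1_on D u" "C1_on D v" "y \<in> D"
    and "\<And>x. x \<in> D \<Longrightarrow> (norm (jacobian v (at x)))\<^sup>2 \<le> M" "M < (norm (jacobian u (at y)))\<^sup>2"
  shows "sup_grad D v < sup_grad D u"
proof -
  have "sup_grad D v \<le> ennreal (sqrt M)"
    unfolding sup_grad_eq_SUP[OF assms(1,3)]
    by (intro SUP_least ennreal_leI real_le_rsqrt assms)
  also have "\<dots> < ennreal (norm (jacobian u (at y)))"
  proof -
    have "0 \<le> M" using assms(4,5) order_trans zero_le_power2 by blast
    then show ?thesis
      using assms(6) by (subst ennreal_less_iff) (auto intro: real_less_lsqrt)
  qed
  also have "\<dots> \<le> sup_grad D u"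
    unfolding sup_grad_eq_SUP[OF assms(1,2)] using assms(4) by (intro SUP_upper)
  finally show ?thesis .
qed

section \<open>Variations of the gradient\<close>

definition outer_product :: "real^'N \<Rightarrow> real^'n \<Rightarrow> real^'n^'N"
  where "outer_product a p = (\<chi> \<alpha> i. a $ \<alpha> * p $ i)"

lemma outer_product_mult_vec: "outer_product a p *v k = (p \<bullet> k) *\<^sub>R a"
  by (simp add: outer_product_def vec_eq_iff matrix_vector_mult_def inner_vec_def
      sum_distrib_right sum_distrib_left mult_ac)

lemma inner_outer_product: "A \<bullet> outer_product a p = (a v* A) \<bullet> p"
proof -
  have "A \<bullet> outer_product a p = (\<Sum>\<alpha>\<in>UNIV. \<Sum>i\<in>UNIV. A $ \<alpha> $ i * (a $ \<alpha> * p $ i))"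
    by (simp add: inner_vec_def outer_product_def)
  also have "\<dots> = (\<Sum>i\<in>UNIV. \<Sum>\<alpha>\<in>UNIV. A $ \<alpha> $ i * (a $ \<alpha> * p $ i))"
    by (rule sum.swap)
  finally show ?thesis
    by (simp add: inner_vec_def outer_product_def vector_matrix_mult_def sum_distrib_left mult_ac)
qed

lemma norm_outer_product: "norm (outer_product a p) = norm a * norm p"
proof -
  have "a v* outer_product a p = (a \<bullet> a) *\<^sub>R p"
    by (simp add: outer_product_def vec_eq_iff vector_matrix_mult_def inner_vec_def
        sum_distrib_left mult_ac)
  then have "(norm (outer_product a p))\<^sup>2 = (norm a * norm p)\<^sup>2"
    by (simp add: power2_norm_eq_inner inner_outer_product power_mult_distrib)
  then show ?thesis by (simp add: power2_eq_iff_nonneg)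
qed

lemma outer_product_0: "outer_product a 0 = 0"
  by (simp add: outer_product_def vec_eq_iff)

text \<open>Covers both kinds of variation: \<open>\<nu>\<close> constant with \<open>B = 0\<close>, and \<open>\<nu>\<close> a normal field.\<close>

lemma jacobian_add_scaleR:
  fixes u \<nu> :: "real^'n \<Rightarrow> real^'N"
  assumes "(u has_derivative (*v) A) (at x)" "(\<nu> has_derivative (*v) B) (at x)"
    and "(h has_derivative (\<lambda>k. p \<bullet> k)) (at x)"
  shows "jacobian (\<lambda>x. u x + h x *\<^sub>R \<nu> x) (at x) = A + (h x *\<^sub>R B + outer_product (\<nu> x) p)"
  by (rule jacobian_eqI,
      rule has_derivative_eq_rhs[OF has_derivative_add[OF assms(1) has_derivative_scaleR[OF assms(3,2)]]])
    (auto simp: matrix_vector_mult_add_rdistrib outer_product_mult_vec scaleR_matrix_vector_assoc)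

lemma norm_add_square: "(norm (a + b))\<^sup>2 = (norm a)\<^sup>2 + 2 * (a \<bullet> b) + (norm b)\<^sup>2"
  for a b :: "'a::real_inner"
  by (simp add: power2_norm_eq_inner algebra_simps inner_commute)

text \<open>The coefficient is the minimiser of \<open>t \<mapsto> |a - t b|\<close>. It gives the size of both perturbations
  used below: of the bump along \<open>\<xi>\<close> and of the constant multiple of a normal field.\<close>

lemma norm_minus_projection_less:
  fixes a b :: "'a::real_inner"
  assumes "a \<bullet> b \<noteq> 0"
  shows "norm (a - (a \<bullet> b / (norm b)\<^sup>2) *\<^sub>R b) < norm a"
proof -
  define t where "t = a \<bullet> b / (norm b)\<^sup>2"
  have b: "norm b \<noteq> 0" using assms by auto
  then have t: "t \<noteq> 0" "t * (norm b)\<^sup>2 = a \<bullet> b" using assms by (simp_all add: t_def)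
  have "(norm (a - t *\<^sub>R b))\<^sup>2 = (norm a)\<^sup>2 - 2 * (t * (a \<bullet> b)) + t\<^sup>2 * (norm b)\<^sup>2"
    using norm_add_square[of a "(- t) *\<^sub>R b"] by (simp add: power_mult_distrib)
  also have "\<dots> = (norm a)\<^sup>2 - t\<^sup>2 * (norm b)\<^sup>2"
    unfolding t(2)[symmetric] by (simp add: power2_eq_square)
  also have "\<dots> < (norm a)\<^sup>2" using t b by simp
  finally have "norm (a - t *\<^sub>R b) < norm a" by (rule power_less_imp_less_base) simp
  then show ?thesis by (simp add: t_def)
qed

lemma has_derivative_const_matrix: "((\<lambda>x. c) has_derivative (*v) (0 :: real^'n^'m)) F"
  by (rule has_derivative_eq_rhs[OF has_derivative_const]) (simp add: fun_eq_iff)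

section \<open>The two parts of the operator\<close>

definition laplacian :: "(real^'n \<Rightarrow> real^'N) \<Rightarrow> real^'n \<Rightarrow> real^'N"
  where "laplacian u x = (\<chi> \<beta>. \<Sum>i\<in>UNIV. D2 u x i i \<beta>)"

text \<open>The gradient of \<open>|Du|\<^sup>2 / 2\<close>, see \<open>has_derivative_energy\<close>.\<close>

definition grad_energy :: "(real^'n \<Rightarrow> real^'N) \<Rightarrow> real^'n \<Rightarrow> real^'n"
  where "grad_energy u x = (\<chi> i. \<Sum>j\<in>UNIV. \<Sum>\<beta>\<in>UNIV. jacobian u (at x) $ \<beta> $ j * D2 u x i j \<beta>)"

lemma tangential_eq: "tangential_inf_laplacian u x = jacobian u (at x) *v grad_energy u x"
  by (simp add: tangential_inf_laplacian_def grad_energy_def vec_eq_iff matrix_vector_mult_def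
      sum_distrib_left mult_ac)

lemma normal_eq:
  "normal_inf_laplacian u x =
    (norm (jacobian u (at x)))\<^sup>2 *\<^sub>R (perp (jacobian u (at x)) *v laplacian u x)"
  by (simp add: normal_inf_laplacian_def laplacian_def vec_eq_iff matrix_vector_mult_def
      sum_distrib_left sum_distrib_right mult_ac)

lemma D2_eq:
  fixes u :: "real^'n \<Rightarrow> real^'N"
  assumes "((\<lambda>y. jacobian u (at y)) has_derivative H) (at x)"
  shows "D2 u x i j \<beta> = H (axis i 1) $ \<beta> $ j"
proof -
  have "((\<lambda>y. jacobian u (at y) $ \<beta> $ j) has_derivative (\<lambda>k. H k $ \<beta> $ j)) (at x)"
    by (intro bounded_linear.has_derivative[OF bounded_linear_vec_nth] assms)
  from frechet_derivative_at[OF this] show ?thesis unfolding D2_def by metis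
qed

lemma linear_eq_sum_axis:
  fixes f :: "real^'n \<Rightarrow> real"
  assumes "linear f" shows "f k = (\<chi> i. f (axis i 1)) \<bullet> k"
proof -
  obtain p where p: "f = (\<lambda>k. p \<bullet> k)" using linear_functional_inner[OF assms] .
  then show ?thesis by (simp add: inner_axis)
qed

lemma has_derivative_energy:
  fixes u :: "real^'n \<Rightarrow> real^'N"
  assumes "open \<Omega>" "C2_on \<Omega> u" "x \<in> \<Omega>"
  shows "((\<lambda>y. (norm (jacobian u (at y)))\<^sup>2) has_derivative (\<lambda>k. 2 * (grad_energy u x \<bullet> k))) (at x)"
proof -
  let ?J = "\<lambda>y. jacobian u (at y)"
  obtain H where H: "(?J has_derivative H) (at x)"
    using C1_on_imp_differentiable[OF C1_on_jacobian[OF assms(1,2)] assms(3)]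
    unfolding differentiable_def by blast
  have lin: "linear (\<lambda>k. ?J x \<bullet> H k)"
    using bounded_linear_compose[OF bounded_linear_inner_right has_derivative_bounded_linear[OF H]]
    by (simp add: bounded_linear.linear)
  have "grad_energy u x = (\<chi> i. ?J x \<bullet> H (axis i 1))"
    unfolding grad_energy_def D2_eq[OF H]
    by (subst sum.swap) (simp add: inner_vec_def)
  then have "?J x \<bullet> H k = grad_energy u x \<bullet> k" for k
    using linear_eq_sum_axis[OF lin] by metis
  then show ?thesis
    unfolding power2_norm_eq_inner
    by (intro has_derivative_eq_rhs[OF has_derivative_inner[OF H H]]) (auto simp: inner_commute)
qed

text \<open>Differentiate the \<open>i\<close>-th component of \<open>\<nu>\<^sup>T Du = 0\<close> in the direction \<open>i\<close> and sum over \<open>i\<close>.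
  In geometric terms: the tangential derivative of a normal field is governed by the second
  fundamental form.\<close>

lemma normal_field_inner_jacobian:
  fixes u :: "real^'n \<Rightarrow> real^'N"
  assumes "open \<Omega>" "C2_on \<Omega> u" "x \<in> \<Omega>" "\<nu> \<in> normal_fields \<Omega> u"
  shows "jacobian u (at x) \<bullet> jacobian \<nu> (at x) = - (laplacian u x \<bullet> \<nu> x)"
proof -
  let ?J = "\<lambda>y. jacobian u (at y)" and ?B = "jacobian \<nu> (at x)"
  have \<nu>: "C1_on \<Omega> \<nu>" "\<And>y. y \<in> \<Omega> \<Longrightarrow> \<nu> y v* ?J y = 0"
    using assms(4) by (auto simp: normal_fields_def)
  obtain H where H: "(?J has_derivative H) (at x)"
    using C1_on_imp_differentiable[OF C1_on_jacobian[OF assms(1,2)] assms(3)]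
    unfolding differentiable_def by blast
  have B: "(\<nu> has_derivative (*v) ?B) (at x)" by (rule C1_on_has_jacobian[OF \<nu>(1) assms(3)])
  have i: "(\<Sum>\<alpha>\<in>UNIV. \<nu> x $ \<alpha> * H (axis i 1) $ \<alpha> $ i + ?B $ \<alpha> $ i * ?J x $ \<alpha> $ i) = 0" for i
  proof -
    have "((\<lambda>y. \<Sum>\<alpha>\<in>UNIV. \<nu> y $ \<alpha> * ?J y $ \<alpha> $ i) has_derivative
       (\<lambda>k. \<Sum>\<alpha>\<in>UNIV. \<nu> x $ \<alpha> * H k $ \<alpha> $ i + (?B *v k) $ \<alpha> * ?J x $ \<alpha> $ i)) (at x)"
      by (intro has_derivative_sum has_derivative_mult
          bounded_linear.has_derivative[OF bounded_linear_vec_nth] H B)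
    moreover have "((\<lambda>y. \<Sum>\<alpha>\<in>UNIV. \<nu> y $ \<alpha> * ?J y $ \<alpha> $ i) has_derivative (\<lambda>k. 0)) (at x)"
    proof (rule has_derivative_transform_within_open[OF has_derivative_const assms(1,3)])
      fix y assume "y \<in> \<Omega>"
      then have "(\<nu> y v* ?J y) $ i = 0" using \<nu>(2) by simp
      then show "0 = (\<Sum>\<alpha>\<in>UNIV. \<nu> y $ \<alpha> * ?J y $ \<alpha> $ i)"
        by (simp add: vector_matrix_mult_def mult_ac)
    qed
    ultimately have "(\<lambda>k. \<Sum>\<alpha>\<in>UNIV. \<nu> x $ \<alpha> * H k $ \<alpha> $ i + (?B *v k) $ \<alpha> * ?J x $ \<alpha> $ i) = (\<lambda>k. 0)"
      by (rule has_derivative_unique)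
    from fun_cong[OF this, of "axis i 1"] show ?thesis by (simp add: matrix_entry_eq[symmetric])
  qed
  have "(\<Sum>i\<in>UNIV. \<Sum>\<alpha>\<in>UNIV. \<nu> x $ \<alpha> * H (axis i 1) $ \<alpha> $ i + ?B $ \<alpha> $ i * ?J x $ \<alpha> $ i) = 0"
    using i by simp
  moreover have "laplacian u x \<bullet> \<nu> x = (\<Sum>i\<in>UNIV. \<Sum>\<alpha>\<in>UNIV. \<nu> x $ \<alpha> * H (axis i 1) $ \<alpha> $ i)"
    by (subst sum.swap) (simp add: laplacian_def D2_eq[OF H] inner_vec_def sum_distrib_left mult_ac)
  moreover have "?J x \<bullet> ?B = (\<Sum>i\<in>UNIV. \<Sum>\<alpha>\<in>UNIV. ?B $ \<alpha> $ i * ?J x $ \<alpha> $ i)"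
    by (subst sum.swap) (simp add: inner_vec_def mult_ac)
  ultimately show ?thesis by (simp add: sum.distrib)
qed


section \<open>Rank-one absolute minimality and the tangential part\<close>

text \<open>To first order the supremum of a function over a ball of radius \<open>r\<close> is its value at the centre
  plus \<open>r\<close> times the length of its gradient. The gap between the two gradients absorbs the
  remainders as soon as \<open>r\<close> is small.\<close>

lemma smaller_gradient_smaller_sup:
  fixes F G :: "'a::euclidean_space \<Rightarrow> real"
  assumes F: "(F has_derivative (\<lambda>k. a \<bullet> k)) (at x0)" and G: "(G has_derivative (\<lambda>k. b \<bullet> k)) (at x0)"
    and eq: "G x0 = F x0" and less: "norm b < norm a" and S: "open S" "x0 \<in> S"
  obtains r y M where "r > 0" "cball x0 r \<subseteq> S" "y \<in> ball x0 r"
    "\<And>x. x \<in> ball x0 r \<Longrightarrow> G x \<le> M" "M < F y"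
proof -
  \<comment> \<open>Slope of the admissible remainder: with a third of the gap on either side, a gap remains.\<close>
  define e where "e = (norm a - norm b) / 3"
  have e: "e > 0" "norm b + e < norm a - e" using less by (simp_all add: e_def field_simps)
  obtain d1 where d1: "d1 > 0"
    "\<And>x. norm (x - x0) < d1 \<Longrightarrow> norm (F x - F x0 - a \<bullet> (x - x0)) \<le> e * norm (x - x0)"
    using F e(1) unfolding has_derivative_at_alt by blast
  obtain d2 where d2: "d2 > 0"
    "\<And>x. norm (x - x0) < d2 \<Longrightarrow> norm (G x - G x0 - b \<bullet> (x - x0)) \<le> e * norm (x - x0)"
    using G e(1) unfolding has_derivative_at_alt by blast
  obtain d3 where d3: "d3 > 0" "cball x0 d3 \<subseteq> S"
    using S open_contains_cball by metis
  define r where "r = min d1 (min d2 d3)"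
  have r: "r > 0" "r \<le> d1" "r \<le> d2" "r \<le> d3" using d1 d2 d3 by (auto simp: r_def)
  have pos: "norm a - e > 0" using e norm_ge_zero[of b] by linarith
  \<comment> \<open>The maximum of the linear part of \<open>F\<close> sits on the sphere; the factor \<open>q < 1\<close> moves the
    competitor into the open ball at the price of less than the gap.\<close>
  have "(norm b + e) / (norm a - e) < 1" using e pos by simp
  then obtain q where q: "(norm b + e) / (norm a - e) < q" "q < 1" using dense by blast
  have q0: "q > 0" using q(1) pos e(1) norm_ge_zero[of b]
    by (meson add_nonneg_pos divide_pos_pos less_trans)
  have qM: "norm b + e < q * (norm a - e)" using q(1) pos by (simp add: divide_less_eq)
  define y where "y = x0 + (q * r) *\<^sub>R sgn a"
  have a0: "a \<noteq> 0" using less norm_ge_zero[of b] by force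
  have ny: "norm (y - x0) = q * r"
    using a0 q0 r by (simp add: y_def norm_sgn)
  have yr: "norm (y - x0) < r" using ny q(2) r(1) by simp
  have ay: "a \<bullet> (y - x0) = q * r * norm a"
    using a0 by (simp add: y_def sgn_div_norm dot_square_norm power2_eq_square)
  define M where "M = F x0 + (norm b + e) * r"
  have "F y \<ge> F x0 + q * r * norm a - e * (q * r)"
    using d1(2)[of y] yr r(2) ny ay by (auto simp: abs_le_iff)
  moreover have "(norm b + e) * r < q * r * norm a - e * (q * r)"
    using mult_strict_right_mono[OF qM r(1)] by (simp add: algebra_simps)
  ultimately have My: "M < F y" by (simp add: M_def)
  have GM: "G x \<le> M" if "x \<in> ball x0 r" for x
  proof -
    have xr: "norm (x - x0) < r" using that by (simp add: dist_norm norm_minus_commute)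
    have "G x - G x0 - b \<bullet> (x - x0) \<le> e * norm (x - x0)"
      using d2(2)[of x] xr r(3) by (auto simp: abs_le_iff)
    moreover have "b \<bullet> (x - x0) \<le> norm b * norm (x - x0)" by (rule norm_cauchy_schwarz)
    moreover have "(norm b + e) * norm (x - x0) \<le> (norm b + e) * r"
      using xr e(1) by (intro mult_left_mono) auto
    ultimately show ?thesis unfolding M_def using eq by (simp add: algebra_simps)
  qed
  show thesis
  proof (rule that[of r y M])
    show "cball x0 r \<subseteq> S" using r(4) d3(2) by (meson subset_cball order_trans)
    show "y \<in> ball x0 r" using yr by (simp add: dist_norm norm_minus_commute)
  qed (use r(1) GM My in auto)
qed

lemma compactly_inside_ball: "r > 0 \<Longrightarrow> cball x r \<subseteq> \<Omega> \<Longrightarrow> ball x r \<subset>\<subset> \<Omega>"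
  for x :: "'a::euclidean_space"
  by (simp add: compactly_inside_def)

text \<open>With \<open>w = \<nabla>(|Du|\<^sup>2 / 2)\<close> and \<open>b = \<xi>\<^sup>T Du\<close> at \<open>x0\<close>, the vector \<open>Du w\<close> has the inner product
  \<open>b \<bullet> w\<close> with \<open>\<xi>\<close>, which is positive when \<open>\<xi>\<close> is the direction of \<open>Du w\<close>. The bump
  \<open>g = t (r\<^sup>2 - |x - x0|\<^sup>2) / 2\<close> vanishes on the sphere of radius \<open>r\<close>, and
  \<open>\<nabla>g = - t (x - x0)\<close> vanishes at the centre. So \<open>|D(u + g \<xi>)|\<^sup>2\<close> agrees with \<open>|Du|\<^sup>2\<close> at
  \<open>x0\<close>, but has the gradient \<open>2 (w - t b)\<close> instead of \<open>2 w\<close>, which is shorter for the right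
  \<open>t\<close>.\<close>

lemma rank_one_absolute_minimal_imp_tangential:
  fixes u :: "real^'n \<Rightarrow> real^'N"
  assumes "open \<Omega>" "C2_on \<Omega> u" "rank_one_absolute_minimal \<Omega> u" and x0: "x0 \<in> \<Omega>"
  shows "tangential_inf_laplacian u x0 = 0"
proof (rule ccontr)
  assume "tangential_inf_laplacian u x0 \<noteq> 0"
  let ?J = "\<lambda>x. jacobian u (at x)"
  define w where "w = grad_energy u x0"
  define T where "T = ?J x0 *v w"
  define \<xi> where "\<xi> = sgn T"
  define b where "b = \<xi> v* ?J x0"
  have T0: "T \<noteq> 0" using \<open>tangential_inf_laplacian u x0 \<noteq> 0\<close> by (simp add: tangential_eq T_def w_def)
  have \<xi>: "norm \<xi> = 1" using T0 by (simp add: \<xi>_def norm_sgn)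
  then have \<xi>1: "\<xi> \<in> sphere 0 1" by simp
  have "b \<bullet> w = \<xi> \<bullet> T" by (simp add: b_def T_def dot_lmul_matrix)
  also have "\<dots> = norm T"
    using T0 by (simp add: \<xi>_def sgn_div_norm dot_square_norm power2_eq_square)
  finally have bw: "b \<bullet> w > 0" using T0 by simp
  define t where "t = (b \<bullet> w) / (norm b)\<^sup>2"
  have wt: "norm (w - t *\<^sub>R b) < norm w"
    using bw norm_minus_projection_less[of w b] by (simp add: t_def inner_commute)
  define F where "F = (\<lambda>x. (norm (?J x))\<^sup>2)"
  \<comment> \<open>\<open>G\<close> is the squared gradient norm of the perturbed map, by the expansion of the square. It
    depends on \<open>t\<close> but not on the radius of the ball, which can therefore be chosen afterwards.\<close>
  define G where "G = (\<lambda>x. F x - 2 * t * ((\<xi> v* ?J x) \<bullet> (x - x0)) + t\<^sup>2 * ((x - x0) \<bullet> (x - x0)))"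
  have F': "(F has_derivative (\<lambda>k. (2 *\<^sub>R w) \<bullet> k)) (at x0)"
    using has_derivative_energy[OF assms(1,2) x0] by (simp add: F_def w_def)
  obtain H where H: "(?J has_derivative H) (at x0)"
    using C1_on_imp_differentiable[OF C1_on_jacobian[OF assms(1,2)] x0]
    unfolding differentiable_def by blast
  have bl: "bounded_linear (\<lambda>A :: real^'n^'N. \<xi> v* A)"
    by (intro linear_conv_bounded_linear[THEN iffD1] linearI)
      (simp_all add: vec_eq_iff vector_matrix_mult_def sum.distrib sum_distrib_left algebra_simps)
  have d: "((\<lambda>x. x - x0) has_derivative (\<lambda>k. k)) (at x0)"
    by (auto intro!: derivative_eq_intros)
  have G': "(G has_derivative (\<lambda>k. (2 *\<^sub>R (w - t *\<^sub>R b)) \<bullet> k)) (at x0)"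
    unfolding G_def
    by (rule has_derivative_eq_rhs[OF has_derivative_add[OF has_derivative_diff[OF F'
          has_derivative_mult_right[OF has_derivative_inner[OF bounded_linear.has_derivative[OF bl H] d]]]
          has_derivative_mult_right[OF has_derivative_inner[OF d d]]]])
      (simp add: fun_eq_iff b_def inner_diff_left)
  have GF: "G x0 = F x0" by (simp add: G_def)
  obtain r y M where r: "r > 0" "cball x0 r \<subseteq> \<Omega>" "y \<in> ball x0 r"
    "\<And>x. x \<in> ball x0 r \<Longrightarrow> G x \<le> M" "M < F y"
    using smaller_gradient_smaller_sup[OF F' G' GF _ assms(1) x0] wt by auto
  define D where "D = ball x0 r"
  define g where "g = (\<lambda>x. t / 2 * (r\<^sup>2 - (x - x0) \<bullet> (x - x0)))"
  have D: "open D" "D \<subseteq> \<Omega>" using r(2) by (auto simp: D_def)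
  have g': "(g has_derivative (\<lambda>k. (- t *\<^sub>R (x - x0)) \<bullet> k)) (at x)" for x
    unfolding g_def by (auto intro!: derivative_eq_intros simp: inner_commute algebra_simps)
  have "C1_on UNIV g"
  proof (rule C1_onI)
    show "(g has_derivative blinfun_apply (blinfun_inner_left (- t *\<^sub>R (x - x0)))) (at x)" for x
      by (rule has_derivative_eq_rhs[OF g']) (simp add: fun_eq_iff inner_commute)
    show "continuous_on UNIV (\<lambda>x. blinfun_inner_left (- t *\<^sub>R (x - x0)))"
      by (intro bounded_linear.continuous_on[OF bounded_linear_blinfun_inner_left] continuous_intros)
  qed
  then have g: "C1_on S g" for S by (rule C1_on_subset) simp
  have "g x = 0" if "x \<in> frontier D" for x
  proof -
    have "norm (x - x0) = r" using that r(1) by (simp add: D_def dist_norm norm_minus_commute)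
    then show ?thesis by (simp add: g_def dot_square_norm)
  qed
  then have g0: "g \<in> C1_0 D"
    using g C1_on_imp_continuous_on[OF g] by (simp add: C1_0_def)
  have uD: "C1_on D u" using C2_on_imp_C1_on[OF assms(2)] D(2) by (rule C1_on_subset)
  have J: "jacobian (\<lambda>x. u x + g x *\<^sub>R \<xi>) (at x) = ?J x + outer_product \<xi> (- t *\<^sub>R (x - x0))"
    if "x \<in> D" for x
  proof -
    from jacobian_add_scaleR[OF C1_on_has_jacobian[OF uD that] has_derivative_const_matrix g']
    show ?thesis by simp
  qed
  have "sup_grad D (\<lambda>x. u x + g x *\<^sub>R \<xi>) < sup_grad D u"
  proof (rule sup_grad_less[where y = y and M = M])
    show "C1_on D (\<lambda>x. u x + g x *\<^sub>R \<xi>)"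
      by (intro C1_on_add uD C1_on_scaleR g C1_on_const)
    show "(norm (jacobian (\<lambda>x. u x + g x *\<^sub>R \<xi>) (at x)))\<^sup>2 \<le> M" if "x \<in> D" for x
    proof -
      have "(norm (jacobian (\<lambda>x. u x + g x *\<^sub>R \<xi>) (at x)))\<^sup>2 = G x"
        unfolding J[OF that] norm_add_square G_def F_def
        by (simp add: norm_outer_product inner_outer_product \<xi> power_mult_distrib dot_square_norm)
      then show ?thesis using r(4) that by (simp add: D_def)
    qed
  qed (use D uD r in \<open>auto simp: D_def F_def\<close>)
  moreover have "D \<subset>\<subset> \<Omega>" unfolding D_def by (rule compactly_inside_ball[OF r(1,2)])
  ultimately show False
    using assms(3) g0 \<xi>1 unfolding rank_one_absolute_minimal_def
    by (meson leD)
qed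

text \<open>If neither extremum over the closure is attained inside, both lie on the frontier and \<open>g\<close> is
  identically zero, so that any point will do.\<close>

lemma extremum_in_open_set:
  fixes g :: "'a::euclidean_space \<Rightarrow> real"
  assumes "open C" "bounded C" "C \<noteq> {}" "continuous_on (closure C) g"
    and zero: "\<And>x. x \<in> frontier C \<Longrightarrow> g x = 0"
  obtains y where "y \<in> C" "(\<forall>z\<in>C. g z \<le> g y) \<or> (\<forall>z\<in>C. g y \<le> g z)"
proof -
  have cpt: "compact (closure C)" and ne: "closure C \<noteq> {}" using assms(2,3) by auto
  obtain a where a: "a \<in> closure C" "\<And>z. z \<in> closure C \<Longrightarrow> g z \<le> g a"
    using continuous_attains_sup[OF cpt ne assms(4)] by blast
  obtain b where b: "b \<in> closure C" "\<And>z. z \<in> closure C \<Longrightarrow> g b \<le> g z"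
    using continuous_attains_inf[OF cpt ne assms(4)] by blast
  have sub: "C \<subseteq> closure C" by (rule closure_subset)
  consider "a \<in> C" | "b \<in> C" | "a \<in> frontier C" "b \<in> frontier C"
    using a(1) b(1) assms(1) by (auto simp: frontier_def interior_open)
  then show thesis
  proof cases
    case 3
    then have "g z = 0" if "z \<in> C" for z
      using a(2) b(2) zero sub that by (metis antisym subsetD)
    moreover obtain y where "y \<in> C" using assms(3) by blast
    ultimately show thesis using that by (metis order_refl)
  qed (use a b sub that in blast)+
qed

text \<open>The set \<open>D\<close> may be disconnected and \<open>|Du|\<close> may take different values on its components.
  Each component has its frontier inside that of \<open>D\<close>, hence contains a critical point of \<open>g\<close>.\<close>

lemma tangential_imp_rank_one_absolute_minimal:
  fixes u :: "real^'n \<Rightarrow> real^'N"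
  assumes "open \<Omega>" "C2_on \<Omega> u" "immersion_on \<Omega> u"
    and T: "\<And>x. x \<in> \<Omega> \<Longrightarrow> tangential_inf_laplacian u x = 0"
  shows "rank_one_absolute_minimal \<Omega> u"
  unfolding rank_one_absolute_minimal_def
proof (intro conjI allI impI)
  show u: "C1_on \<Omega> u" by (rule C2_on_imp_C1_on[OF assms(2)])
  let ?J = "\<lambda>x. jacobian u (at x)"
  fix D g and \<xi> :: "real^'N"
  assume D': "D \<subset>\<subset> \<Omega>" and g': "g \<in> C1_0 D" and "\<xi> \<in> sphere 0 1"
  have D: "open D" "bounded D" "D \<subseteq> \<Omega>"
    using D' closure_subset[of D] bounded_subset[OF compact_imp_bounded closure_subset, of D]
    by (auto simp: compactly_inside_def)
  have g: "C1_on D g" "continuous_on (closure D) g" "\<And>x. x \<in> frontier D \<Longrightarrow> g x = 0"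
    using g' by (auto simp: C1_0_def)
  have uD: "C1_on D u" by (rule C1_on_subset[OF u D(3)])
  have vD: "C1_on D (\<lambda>x. u x + g x *\<^sub>R \<xi>)"
    by (intro C1_on_add uD C1_on_scaleR g C1_on_const)
  have grad0: "grad_energy u x = 0" if "x \<in> \<Omega>" for x
  proof -
    have "inj ((*v) (?J x))" using assms(3) that by (simp add: immersion_on_def full_rank_injective)
    moreover have "?J x *v grad_energy u x = ?J x *v 0" using T[OF that] by (simp add: tangential_eq)
    ultimately show ?thesis by (rule injD)
  qed
  show "sup_grad D u \<le> sup_grad D (\<lambda>x. u x + g x *\<^sub>R \<xi>)"
    unfolding sup_grad_eq_SUP[OF D(1) uD] sup_grad_eq_SUP[OF D(1) vD]
  proof (rule SUP_mono)
    fix x assume x: "x \<in> D"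
    define C where "C = connected_component_set D x"
    have C: "C \<in> components D" "x \<in> C" "C \<subseteq> D" "connected C"
      using x by (auto simp: C_def components_def connected_component_subset)
    have "open C" using D(1) C(1) by (rule open_components)
    obtain y where y: "y \<in> C" "(\<forall>z\<in>C. g z \<le> g y) \<or> (\<forall>z\<in>C. g y \<le> g z)"
    proof (rule extremum_in_open_set[of C g])
      show "bounded C" using D(2) C(3) by (rule bounded_subset)
      show "continuous_on (closure C) g"
        by (rule continuous_on_subset[OF g(2) closure_mono[OF C(3)]])
      show "g z = 0" if "z \<in> frontier C" for z
        using frontier_of_components_subset[OF C(1)] g(3) that by blast
    qed (use \<open>open C\<close> C(2) in auto)
    have yD: "y \<in> D" using y C by blast
    obtain g' where "(g has_derivative g') (at y)"
      using C1_on_imp_differentiable[OF g(1) yD] unfolding differentiable_def by blast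
    then have "(g has_derivative (\<lambda>k. 0)) (at y)"
      using differential_zero_maxmin[OF y(1) \<open>open C\<close> _ y(2)] by metis
    then have g0: "(g has_derivative (\<lambda>k. 0 \<bullet> k)) (at y)" by simp
    from jacobian_add_scaleR[OF C1_on_has_jacobian[OF uD yD] has_derivative_const_matrix g0]
    have J: "jacobian (\<lambda>x. u x + g x *\<^sub>R \<xi>) (at y) = ?J y" by (simp add: outer_product_0)
    have "(norm (?J x))\<^sup>2 = (norm (?J y))\<^sup>2"
    proof -
      have "((\<lambda>z. (norm (?J z))\<^sup>2) has_derivative (\<lambda>k. 0)) (at z within C)" if "z \<in> C" for z
        using has_derivative_energy[OF assms(1,2), of z] grad0[of z] that C(3) D(3)
        by (auto intro: has_derivative_at_withinI)
      then obtain c where "\<And>z. z \<in> C \<Longrightarrow> (norm (?J z))\<^sup>2 = c"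
        using has_derivative_zero_unique_connected[OF \<open>open C\<close> C(4), of "\<lambda>z. (norm (?J z))\<^sup>2"]
          C(2) \<open>open C\<close> at_within_open by metis
      then show ?thesis using y(1) C(2) by simp
    qed
    then have "norm (?J x) = norm (?J y)" by (simp add: power2_eq_iff_nonneg)
    then show "\<exists>y\<in>D. ennreal (norm (?J x)) \<le> ennreal (norm (jacobian (\<lambda>x. u x + g x *\<^sub>R \<xi>) (at y)))"
      using yD J by (intro bexI[of _ y]) auto
  qed
qed

section \<open>Minimal area and the normal part\<close>

text \<open>The obvious candidate is the projection \<open>v - Du (Du\<^sup>T Du)\<^sup>-\<^sup>1 Du\<^sup>T v\<close> of a constant vector onto
  the normal space. Multiplied by \<open>det (Du\<^sup>T Du)\<close> it becomes, by Cramer's rule, a polynomial in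
  the entries of \<open>Du\<close>, and so visibly \<open>C\<^sup>1\<close>.\<close>

lemma normal_field_through:
  fixes u :: "real^'n \<Rightarrow> real^'N"
  assumes "open \<Omega>" "C2_on \<Omega> u" "immersion_on \<Omega> u" and x: "x \<in> \<Omega>"
    and v: "v v* jacobian u (at x) = 0"
  obtains \<nu> c where "\<nu> \<in> normal_fields \<Omega> u" "c \<noteq> 0" "\<nu> x = c *\<^sub>R v"
proof -
  let ?J = "\<lambda>y. jacobian u (at y)"
  define G where "G = (\<lambda>y. transpose (?J y) ** ?J y)"
  define b where "b = (\<lambda>y. v v* ?J y)"
  define p :: "real^'n \<Rightarrow> real^'n"
    where "p = (\<lambda>y. \<chi> k. det (\<chi> i j. if j = k then b y $ i else G y $ i $ j))"
  define \<nu> where "\<nu> = (\<lambda>y. det (G y) *\<^sub>R v - ?J y *v p y)"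
  have det: "det (G y) \<noteq> 0" if "y \<in> \<Omega>" for y
  proof -
    have inj: "inj ((*v) (?J y))" using assms(3) that by (simp add: immersion_on_def full_rank_injective)
    have "z = 0" if "G y *v z = 0" for z
    proof -
      have "(?J y *v z) \<bullet> (?J y *v z) = (G y *v z) \<bullet> z"
        by (simp add: G_def matrix_vector_mul_assoc[symmetric] dot_lmul_matrix)
      then have "?J y *v z = ?J y *v 0" using that by simp
      then show ?thesis by (rule injD[OF inj])
    qed
    then have "invertible (G y)"
      by (simp add: invertible_left_inverse matrix_left_invertible_ker)
    then show ?thesis by (simp add: invertible_det_nz)
  qed
  have p: "G y *v p y = det (G y) *\<^sub>R b y" if "y \<in> \<Omega>" for y
  proof -
    have "G y *v ((1 / det (G y)) *\<^sub>R p y) = b y"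
      by (subst cramer[OF det[OF that]]) (simp add: p_def vec_eq_iff)
    then have "(1 / det (G y)) *\<^sub>R (G y *v p y) = b y"
      by (simp add: matrix_vector_mult_scaleR)
    then have "det (G y) *\<^sub>R ((1 / det (G y)) *\<^sub>R (G y *v p y)) = det (G y) *\<^sub>R b y" by simp
    then show ?thesis using det[OF that] by simp
  qed
  have J: "C1_on \<Omega> (\<lambda>y. ?J y $ \<alpha> $ i)" for \<alpha> i
    by (intro C1_on_vec_nth C1_on_jacobian assms)
  have G: "C1_on \<Omega> (\<lambda>y. G y $ i $ j)" for i j
    unfolding G_def matrix_matrix_mult_def transpose_def
    by simp (intro C1_on_sum C1_on_mult J)
  have b: "C1_on \<Omega> (\<lambda>y. b y $ i)" for i
    unfolding b_def vector_matrix_mult_def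
    by simp (intro C1_on_sum C1_on_mult J C1_on_const)
  have pk: "C1_on \<Omega> (\<lambda>y. p y $ k)" for k
    unfolding p_def vec_lambda_beta
  proof (rule C1_on_det)
    show "C1_on \<Omega> (\<lambda>y. (\<chi> i j. if j = k then b y $ i else G y $ i $ j) $ i $ j)" for i j
      using G b by (cases "j = k") simp_all
  qed
  have "C1_on \<Omega> (\<lambda>y. ?J y *v p y)"
    unfolding matrix_vector_mult_def
    by (intro C1_on_vec_lambda C1_on_sum C1_on_mult J pk)
  then have "C1_on \<Omega> \<nu>"
    unfolding \<nu>_def by (intro C1_on_diff C1_on_scaleR C1_on_det G C1_on_const)
  moreover have "\<nu> y v* ?J y = 0" if "y \<in> \<Omega>" for y
  proof -
    have "\<nu> y v* ?J y = transpose (?J y) *v \<nu> y" by simp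
    also have "\<dots> = det (G y) *\<^sub>R b y - G y *v p y"
      by (simp add: \<nu>_def matrix_vector_mult_diff_distrib matrix_vector_mult_scaleR G_def
          matrix_vector_mul_assoc[symmetric] b_def)
    finally show ?thesis using p[OF that] by simp
  qed
  ultimately have "\<nu> \<in> normal_fields \<Omega> u" by (simp add: normal_fields_def)
  moreover have "\<nu> x = det (G x) *\<^sub>R v"
  proof -
    have "G x *v 0 = b x" using v by (simp add: b_def)
    then have "0 = (1 / det (G x)) *\<^sub>R p x"
      unfolding cramer[OF det[OF x]] by (simp add: p_def vec_eq_iff)
    then show ?thesis using det[OF x] by (simp add: \<nu>_def)
  qed
  ultimately show thesis using that det[OF x] by blast
qed

text \<open>Take \<open>v\<close> to be the normal component of \<open>\<Delta>u\<close> at \<open>x0\<close>, so that \<open>\<Delta>u \<bullet> v = |v|\<^sup>2\<close>, and a normal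
  field through it. Constants are admissible factors \<open>h\<close>, as no boundary condition is imposed, and
  the best constant lowers \<open>|Du|\<close> strictly at \<open>x0\<close>. By continuity the values on a small ball then
  stay below the original value at its centre.\<close>

lemma minimal_area_imp_normal:
  fixes u :: "real^'n \<Rightarrow> real^'N"
  assumes "open \<Omega>" "C2_on \<Omega> u" "inf_minimal_area \<Omega> u" and x0: "x0 \<in> \<Omega>"
  shows "normal_inf_laplacian u x0 = 0"
proof (rule ccontr)
  assume ne: "normal_inf_laplacian u x0 \<noteq> 0"
  let ?J = "\<lambda>x. jacobian u (at x)"
  define v where "v = perp (?J x0) *v laplacian u x0"
  have v0: "v \<noteq> 0" using ne by (auto simp: normal_eq v_def)
  have vJ: "v v* ?J x0 = 0" using perp_works(1)[of "?J x0"] by (simp add: v_def)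
  have "orthogonal (laplacian u x0 - v) v"
    unfolding v_def by (rule perp_works(2)) (rule perp_works(1))
  then have lv: "laplacian u x0 \<bullet> v = v \<bullet> v" by (simp add: orthogonal_def inner_diff_left)
  have imm: "immersion_on \<Omega> u" using assms(3) by (simp add: inf_minimal_area_def)
  obtain \<nu> c where \<nu>: "\<nu> \<in> normal_fields \<Omega> u" "c \<noteq> 0" "\<nu> x0 = c *\<^sub>R v"
    using normal_field_through[OF assms(1,2) imm x0 vJ] by blast
  let ?B = "\<lambda>x. jacobian \<nu> (at x)"
  have u1: "C1_on \<Omega> u" by (rule C2_on_imp_C1_on[OF assms(2)])
  have \<nu>1: "C1_on \<Omega> \<nu>" using \<nu>(1) by (simp add: normal_fields_def)
  define q where "q = ?J x0 \<bullet> ?B x0"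
  have q0: "q \<noteq> 0"
    using normal_field_inner_jacobian[OF assms(1,2) x0 \<nu>(1)] \<nu>(2,3) lv v0 by (simp add: q_def)
  define t where "t = - q / (norm (?B x0))\<^sup>2"
  define E where "E = (\<lambda>x. (norm (?J x + t *\<^sub>R ?B x))\<^sup>2)"
  define M where "M = (E x0 + (norm (?J x0))\<^sup>2) / 2"
  have "norm (?J x0 + t *\<^sub>R ?B x0) < norm (?J x0)"
    using q0 norm_minus_projection_less[of "?J x0" "?B x0"] by (simp add: t_def q_def)
  then have "E x0 < (norm (?J x0))\<^sup>2" unfolding E_def by (rule power_strict_mono) simp_all
  then have EM: "E x0 < M" "M < (norm (?J x0))\<^sup>2" by (simp_all add: M_def)
  have "continuous_on \<Omega> E"
    unfolding E_def by (intro continuous_intros continuous_on_jacobian u1 \<nu>1)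
  then have "open (\<Omega> \<inter> E -` {..<M})"
    by (rule continuous_open_preimage[OF _ assms(1) open_lessThan])
  also have "\<Omega> \<inter> E -` {..<M} = {x \<in> \<Omega>. E x < M}" by auto
  finally have "open {x \<in> \<Omega>. E x < M}" .
  then obtain r where r: "r > 0" "cball x0 r \<subseteq> {x \<in> \<Omega>. E x < M}"
    using x0 EM(1) open_contains_cball by (metis (mono_tags, lifting) mem_Collect_eq)
  define D where "D = ball x0 r"
  have DM: "D \<subseteq> {x \<in> \<Omega>. E x < M}"
    unfolding D_def by (rule order_trans[OF ball_subset_cball r(2)])
  then have D: "open D" "D \<subseteq> \<Omega>" "x0 \<in> D" using r(1) by (auto simp: D_def)
  have uD: "C1_on D u" "C1_on D \<nu>" using C1_on_subset D(2) u1 \<nu>1 by blast+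
  have "sup_grad D (\<lambda>x. u x + t *\<^sub>R \<nu> x) < sup_grad D u"
  proof (rule sup_grad_less[where y = x0 and M = M])
    show "C1_on D (\<lambda>x. u x + t *\<^sub>R \<nu> x)" by (intro C1_on_add C1_on_scaleR C1_on_const uD)
    show "(norm (jacobian (\<lambda>x. u x + t *\<^sub>R \<nu> x) (at x)))\<^sup>2 \<le> M" if "x \<in> D" for x
    proof -
      have "((\<lambda>x. t) has_derivative (\<lambda>k. 0 \<bullet> k)) (at x)" by simp
      from jacobian_add_scaleR[OF C1_on_has_jacobian[OF uD(1) that]
          C1_on_has_jacobian[OF uD(2) that] this]
      have "jacobian (\<lambda>x. u x + t *\<^sub>R \<nu> x) (at x) = ?J x + t *\<^sub>R ?B x"
        by (simp add: outer_product_0)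
      moreover have "E x < M" using DM that by auto
      ultimately show ?thesis by (simp add: E_def)
    qed
  qed (use D uD EM in auto)
  moreover have "D \<subset>\<subset> \<Omega>" unfolding D_def using r by (intro compactly_inside_ball) auto
  moreover have "(\<lambda>x. t) \<in> C1_closure D"
    unfolding C1_closure_def
    by (auto intro!: exI[of _ "\<lambda>_. 0"] simp: zero_blinfun.rep_eq)
  ultimately show False
    using assms(3) \<nu>(1) unfolding inf_minimal_area_def by (meson leD)
qed

text \<open>On an immersion \<open>Du\<close> has no zeros, so the factor \<open>|Du|\<^sup>2\<close> can be cancelled and \<open>\<Delta>u\<close> is
  tangential. The variation is then orthogonal to \<open>Du\<close> and can only lengthen it.\<close>

lemma normal_imp_minimal_area:
  fixes u :: "real^'n \<Rightarrow> real^'N"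
  assumes "open \<Omega>" "C2_on \<Omega> u" "immersion_on \<Omega> u"
    and N: "\<And>x. x \<in> \<Omega> \<Longrightarrow> normal_inf_laplacian u x = 0"
  shows "inf_minimal_area \<Omega> u"
  unfolding inf_minimal_area_def
proof (intro conjI allI impI)
  show "immersion_on \<Omega> u" by fact
  let ?J = "\<lambda>x. jacobian u (at x)"
  fix D h \<nu>
  assume D': "D \<subset>\<subset> \<Omega>" and h': "h \<in> C1_closure D" and \<nu>: "\<nu> \<in> normal_fields \<Omega> u"
  have D: "open D" "D \<subseteq> \<Omega>" using D' closure_subset[of D] by (auto simp: compactly_inside_def)
  have h: "C1_on D h"
    using h' continuous_on_subset[OF _ closure_subset]
    unfolding C1_closure_def C1_on_def by blast
  have \<nu>1: "C1_on \<Omega> \<nu>" "\<And>x. x \<in> \<Omega> \<Longrightarrow> \<nu> x v* ?J x = 0" using \<nu> by (auto simp: normal_fields_def)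
  have uD: "C1_on D u" "C1_on D \<nu>"
    using C1_on_subset[OF _ D(2)] C2_on_imp_C1_on[OF assms(2)] \<nu>1 by blast+
  have vD: "C1_on D (\<lambda>x. u x + h x *\<^sub>R \<nu> x)" by (intro C1_on_add C1_on_scaleR uD h)
  show "sup_grad D u \<le> sup_grad D (\<lambda>x. u x + h x *\<^sub>R \<nu> x)"
    unfolding sup_grad_eq_SUP[OF D(1) uD(1)] sup_grad_eq_SUP[OF D(1) vD]
  proof (rule SUP_mono)
    fix x assume xD: "x \<in> D"
    then have x: "x \<in> \<Omega>" using D(2) by blast
    have "rank (?J x) \<noteq> 0" using assms(3) x by (simp add: immersion_on_def)
    then have "?J x \<noteq> 0" by (metis rank_0)
    then have "perp (?J x) *v laplacian u x = 0" using N[OF x] by (simp add: normal_eq)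
    then have "orthogonal (laplacian u x) (\<nu> x)"
      using perp_works(2)[of "?J x" "\<nu> x" "laplacian u x"] \<nu>1(2)[OF x]
      by simp
    then have JB: "?J x \<bullet> jacobian \<nu> (at x) = 0"
      using normal_field_inner_jacobian[OF assms(1,2) x \<nu>] by (simp add: orthogonal_def)
    obtain h' where h': "(h has_derivative h') (at x)"
      using C1_on_imp_differentiable[OF h xD] unfolding differentiable_def by blast
    obtain p where p: "h' = (\<lambda>k. p \<bullet> k)"
      using linear_functional_inner[OF has_derivative_linear[OF h']] .
    let ?V = "h x *\<^sub>R jacobian \<nu> (at x) + outer_product (\<nu> x) p"
    have JV: "?J x \<bullet> ?V = 0" using JB \<nu>1(2)[OF x] by (simp add: inner_add_right inner_outer_product)
    have "(norm (?J x))\<^sup>2 \<le> (norm (?J x + ?V))\<^sup>2"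
      unfolding norm_add_square[of "?J x" ?V] JV by simp
    then have "norm (?J x) \<le> norm (?J x + ?V)" by (rule power2_le_imp_le) simp
    moreover have "jacobian (\<lambda>x. u x + h x *\<^sub>R \<nu> x) (at x) = ?J x + ?V"
      using jacobian_add_scaleR[OF C1_on_has_jacobian[OF uD(1) xD]
          C1_on_has_jacobian[OF uD(2) xD] h'[unfolded p]] .
    ultimately show
      "\<exists>y\<in>D. ennreal (norm (?J x)) \<le> ennreal (norm (jacobian (\<lambda>x. u x + h x *\<^sub>R \<nu> x) (at y)))"
      using xD by (intro bexI[of _ x]) (auto intro: ennreal_leI)
  qed
qed

section \<open>The full operator\<close>

lemma inf_laplacian_eq_0_iff:
  "inf_laplacian u x = 0 \<longleftrightarrow> tangential_inf_laplacian u x = 0 \<and> normal_inf_laplacian u x = 0"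
proof -
  let ?A = "jacobian u (at x)"
  have "(perp ?A *v laplacian u x) \<bullet> (?A *v grad_energy u x) = 0"
    using perp_works(1)[of ?A "laplacian u x"]
    by (simp add: dot_lmul_matrix[symmetric])
  then have "orthogonal (tangential_inf_laplacian u x) (normal_inf_laplacian u x)"
    by (simp add: tangential_eq normal_eq orthogonal_def inner_commute)
  then show ?thesis
    unfolding inf_laplacian_def
    by (metis add.right_neutral add_eq_0_iff orthogonal_def inner_minus_right neg_equal_0_iff_equal
        inner_eq_zero_iff)
qed

lemma submersion_imp_normal:
  assumes "submersion_on \<Omega> u" "x \<in> \<Omega>"
  shows "normal_inf_laplacian u x = 0"
proof -
  let ?A = "jacobian u (at x)"
  have "inj ((*v) (transpose ?A))"
    using assms by (simp add: submersion_on_def full_rank_injective[symmetric] rank_transpose)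
  moreover have "transpose ?A *v (perp ?A *v laplacian u x) = transpose ?A *v 0"
    unfolding perp_works(1) by simp
  ultimately have "perp ?A *v laplacian u x = 0" by (rule injD)
  then show ?thesis by (simp add: normal_eq)
qed

lemma immersion_imp_full_rank: "immersion_on \<Omega> u \<Longrightarrow> full_rank_on \<Omega> u"
  by (simp add: immersion_on_def full_rank_on_def)

theorem theorem2p2:
  fixes \<Omega> :: "(real^'n) set" and u :: "real^'n \<Rightarrow> real^'N"
  assumes "open \<Omega>" and "C2_on \<Omega> u"
  shows
    "((inf_minimal_map \<Omega> u \<longrightarrow> (\<forall>x\<in>\<Omega>. inf_laplacian u x = 0)) \<and>
      (immersion_on \<Omega> u \<longrightarrow> (\<forall>x\<in>\<Omega>. inf_laplacian u x = 0) \<longrightarrow> inf_minimal_map \<Omega> u)) \<and>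
     ((rank_one_absolute_minimal \<Omega> u \<longrightarrow> (\<forall>x\<in>\<Omega>. tangential_inf_laplacian u x = 0)) \<and>
      (immersion_on \<Omega> u \<longrightarrow> (\<forall>x\<in>\<Omega>. tangential_inf_laplacian u x = 0) \<longrightarrow>
        rank_one_absolute_minimal \<Omega> u)) \<and>
     (immersion_on \<Omega> u \<longrightarrow>
        (inf_minimal_area \<Omega> u \<longleftrightarrow> (\<forall>x\<in>\<Omega>. normal_inf_laplacian u x = 0)))"
  unfolding inf_laplacian_eq_0_iff inf_minimal_map_def
  using rank_one_absolute_minimal_imp_tangential[OF assms]
    tangential_imp_rank_one_absolute_minimal[OF assms]
    minimal_area_imp_normal[OF assms] normal_imp_minimal_area[OF assms]
    submersion_imp_normal[of \<Omega> u] immersion_imp_full_rank[of \<Omega> u]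
  by blast

end
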